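(* Let $T$ be a Hausdorff topological group, $X$ a compact Hausdorff space, $T\curvearrowright X$ a minimal flow, and $H\in\mathcal S^{\mathrm{ncc}}(T)$. Then for all $x\in X$ the evaluation mapping $$\mathfrak e\colon T/E_x[H]\to X/H,\qquad tE_x[H]\mapsto t\overline{Hx},$$ is an isomorphism from the flow $T\curvearrowright T/E_x[H]$ onto the flow $T\curvearrowright X/H$; moreover, $T\curvearrowright X/H$ is an almost periodic factor of $T\curvearrowright X$.
   Context: A flow $T\curvearrowright X$ is a jointly continuous map $T\times X\to X$, $(t,x)\mapsto tx$, with $ex=x$ and $(st)x=s(tx)$. It is minimal if $\overline{Tx}=X$ for all $x\in X$. A subgroup $H$ of $T$ is co-compact if the left-coset space $T/H$ (quotient topology) is compact; $\mathcal S^{\mathrm{ncc}}(T)$ is the family of normal co-compact closed subgroups of $T$. For $x\in X$, the $x$-envelope of $H$ is $E_x[H]=\{t\in T\mid tx\in\overline{Hx}\}$; in the present setting it is a co-compact closed subgroup of $T$, and $T$ acts on the left-coset space $T/E_x[H]$ by left translation. Let $R_H=\{(x,x')\in X\times X\mid x'\in\overline{Hx}\}$ and $X/H:=X/R_H$ with the quotient topology; in the present setting $R_H$ is a closed $T$-invariant equivalence relation on $X$ whose classes are the sets $\overline{Hx}$, and $T\curvearrowright X/H$ is the induced action $(t,\overline{Hx})\mapsto t\overline{Hx}=\overline{Htx}$. An isomorphism of flows is a $T$-equivariant homeomorphism. A flow $T\curvearrowright Z$ is a factor of $T\curvearrowright X$ if there is a continuous $T$-equivariant surjection $X\to Z$.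 A subset $A\subseteq T$ is syndetic if $T=K^{-1}A$ for some nonempty compact $K\subseteq T$. A flow on a compact Hausdorff space $Z$ with uniformity $\mathscr U$ is almost periodic if for each $\alpha\in\mathscr U$ there is a syndetic set $A\subseteq T$ with $Az\subseteq\alpha[z]$ for all $z\in Z$; equivalently, it is equicontinuous, i.e. for every $\varepsilon\in\mathscr U$ there is $\delta\in\mathscr U$ with $T\delta\subseteq\varepsilon$. *)

theory Defs
  imports "HOL-Analysis.Analysis" "HOL-Algebra.Coset"
begin

text \<open>Group operations come from the HOL-Algebra structure \<open>G\<close>; its topology is a separate
  parameter \<open>TG\<close> with underlying set \<open>carrier G\<close>. No separation axiom is built in.\<close>

locale topological_group = group G for G (structure) +
  fixes TG :: "'a topology"
  assumes topspace_eq_carrier: "topspace TG = carrier G"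
    and continuous_mult: "continuous_map (prod_topology TG TG) TG (\<lambda>(s, t). s \<otimes> t)"
    and continuous_inv: "continuous_map TG TG (\<lambda>t. inv t)"


definition quotient_topology :: "'a topology \<Rightarrow> ('a \<Rightarrow> 'b) \<Rightarrow> 'b topology" where
  "quotient_topology X q =
     topology (\<lambda>V. V \<subseteq> q ` topspace X \<and> openin X {x \<in> topspace X. q x \<in> V})"

lemma openin_quotient_topology:
  "openin (quotient_topology X q) V \<longleftrightarrow>
     V \<subseteq> q ` topspace X \<and> openin X {x \<in> topspace X. q x \<in> V}"
proof -
  have "istopology (\<lambda>V. V \<subseteq> q ` topspace X \<and> openin X {x \<in> topspace X. q x \<in> V})"
    unfolding istopology_def
  proof (intro conjI allI impI)
    fix S T
    assume S: "S \<subseteq> q ` topspace X \<and> openin X {x \<in> topspace X. q x \<in> S}"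
      and T: "T \<subseteq> q ` topspace X \<and> openin X {x \<in> topspace X. q x \<in> T}"
    have "{x \<in> topspace X. q x \<in> S \<inter> T}
        = {x \<in> topspace X. q x \<in> S} \<inter> {x \<in> topspace X. q x \<in> T}" by auto
    then show "openin X {x \<in> topspace X. q x \<in> S \<inter> T}" using S T by (simp add: openin_Int)
    show "S \<inter> T \<subseteq> q ` topspace X" using S by blast
  next
    fix \<K>
    assume K: "\<forall>K\<in>\<K>. K \<subseteq> q ` topspace X \<and> openin X {x \<in> topspace X. q x \<in> K}"
    have "{x \<in> topspace X. q x \<in> \<Union>\<K>} = (\<Union>K\<in>\<K>. {x \<in> topspace X. q x \<in> K})" by auto
    moreover have "openin X (\<Union>K\<in>\<K>. {x \<in> topspace X. q x \<in> K})"
      using K by (intro openin_Union) blast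
    ultimately show "openin X {x \<in> topspace X. q x \<in> \<Union>\<K>}" by simp
    show "\<Union>\<K> \<subseteq> q ` topspace X" using K by blast
  qed
  then show ?thesis by (simp add: quotient_topology_def)
qed

lemma topspace_quotient_topology: "topspace (quotient_topology X q) = q ` topspace X"
proof
  show "topspace (quotient_topology X q) \<subseteq> q ` topspace X"
    using openin_topspace[of "quotient_topology X q"] unfolding openin_quotient_topology by blast
  have "{x \<in> topspace X. q x \<in> q ` topspace X} = topspace X" by auto
  then have "openin (quotient_topology X q) (q ` topspace X)"
    by (simp add: openin_quotient_topology)
  then show "q ` topspace X \<subseteq> topspace (quotient_topology X q)"
    by (rule openin_subset)
qed

lemma quotient_map_quotient_topology: "quotient_map X (quotient_topology X q) q"
  unfolding quotient_map_def topspace_quotient_topology openin_quotient_topology by auto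


definition left_coset_space :: "('g, 'm) monoid_scheme \<Rightarrow> 'g topology \<Rightarrow> 'g set \<Rightarrow> 'g set topology"
  where "left_coset_space G TG H = quotient_topology TG (\<lambda>t. t <#\<^bsub>G\<^esub> H)"

definition normal_cocompact_closed ::
    "('g, 'm) monoid_scheme \<Rightarrow> 'g topology \<Rightarrow> 'g set set" where
  "normal_cocompact_closed G TG =
     {H. H \<lhd> G \<and> closedin TG H \<and> compact_space (left_coset_space G TG H)}"

definition flow ::
    "('g, 'm) monoid_scheme \<Rightarrow> 'g topology \<Rightarrow> 'x topology \<Rightarrow> ('g \<Rightarrow> 'x \<Rightarrow> 'x) \<Rightarrow> bool" where
  "flow G TG X act \<longleftrightarrow>
     continuous_map (prod_topology TG X) X (\<lambda>(t, x). act t x) \<and>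
     (\<forall>x \<in> topspace X. act \<one>\<^bsub>G\<^esub> x = x) \<and>
     (\<forall>s \<in> carrier G. \<forall>t \<in> carrier G. \<forall>x \<in> topspace X.
        act (s \<otimes>\<^bsub>G\<^esub> t) x = act s (act t x))"

text \<open>\<open>orbit_closure X act S x\<close> is the closure of \<open>S x\<close>, for any set \<open>S\<close> of group elements.\<close>

definition orbit_closure :: "'x topology \<Rightarrow> ('g \<Rightarrow> 'x \<Rightarrow> 'x) \<Rightarrow> 'g set \<Rightarrow> 'x \<Rightarrow> 'x set" where
  "orbit_closure X act S x = X closure_of ((\<lambda>t. act t x) ` S)"

definition minimal_flow ::
    "('g, 'm) monoid_scheme \<Rightarrow> 'g topology \<Rightarrow> 'x topology \<Rightarrow> ('g \<Rightarrow> 'x \<Rightarrow> 'x) \<Rightarrow> bool" where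
  "minimal_flow G TG X act \<longleftrightarrow>
     flow G TG X act \<and> (\<forall>x \<in> topspace X. orbit_closure X act (carrier G) x = topspace X)"

definition envelope ::
    "('g, 'm) monoid_scheme \<Rightarrow> 'x topology \<Rightarrow> ('g \<Rightarrow> 'x \<Rightarrow> 'x) \<Rightarrow> 'g set \<Rightarrow> 'x \<Rightarrow> 'g set" where
  "envelope G X act H x = {t \<in> carrier G. act t x \<in> orbit_closure X act H x}"

definition orbit_closure_rel ::
    "'x topology \<Rightarrow> ('g \<Rightarrow> 'x \<Rightarrow> 'x) \<Rightarrow> 'g set \<Rightarrow> ('x \<times> 'x) set" where
  "orbit_closure_rel X act H =
     {(x, x'). x \<in> topspace X \<and> x' \<in> topspace X \<and> x' \<in> orbit_closure X act H x}"

definition orbit_closure_space ::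
    "'x topology \<Rightarrow> ('g \<Rightarrow> 'x \<Rightarrow> 'x) \<Rightarrow> 'g set \<Rightarrow> 'x set topology" where
  "orbit_closure_space X act H = quotient_topology X (\<lambda>x. orbit_closure_rel X act H `` {x})"

lemma topspace_orbit_closure_space:
  "topspace (orbit_closure_space X act H) = topspace X // orbit_closure_rel X act H"
  by (auto simp: orbit_closure_space_def topspace_quotient_topology quotient_def)

lemma orbit_closure_rel_Image:
  "x \<in> topspace X \<Longrightarrow> orbit_closure_rel X act H `` {x} = orbit_closure X act H x"
  using closure_of_subset_topspace[of X "(\<lambda>t. act t x) ` H"]
  by (auto simp: orbit_closure_rel_def orbit_closure_def)


definition equivariant ::
    "('g, 'm) monoid_scheme \<Rightarrow> 'y topology \<Rightarrow> ('g \<Rightarrow> 'y \<Rightarrow> 'y) \<Rightarrow> ('g \<Rightarrow> 'z \<Rightarrow> 'z) \<Rightarrow> ('y \<Rightarrow> 'z) \<Rightarrow> bool"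
  where
  "equivariant G Y actY actZ f \<longleftrightarrow>
     (\<forall>t \<in> carrier G. \<forall>y \<in> topspace Y. f (actY t y) = actZ t (f y))"

definition flow_isomorphism ::
    "('g, 'm) monoid_scheme \<Rightarrow> 'g topology \<Rightarrow> 'y topology \<Rightarrow> ('g \<Rightarrow> 'y \<Rightarrow> 'y) \<Rightarrow>
     'z topology \<Rightarrow> ('g \<Rightarrow> 'z \<Rightarrow> 'z) \<Rightarrow> ('y \<Rightarrow> 'z) \<Rightarrow> bool" where
  "flow_isomorphism G TG Y actY Z actZ f \<longleftrightarrow>
     flow G TG Y actY \<and> flow G TG Z actZ \<and>
     homeomorphic_map Y Z f \<and> equivariant G Y actY actZ f"

definition flow_factor ::
    "('g, 'm) monoid_scheme \<Rightarrow> 'g topology \<Rightarrow> 'x topology \<Rightarrow> ('g \<Rightarrow> 'x \<Rightarrow> 'x) \<Rightarrow>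
     'z topology \<Rightarrow> ('g \<Rightarrow> 'z \<Rightarrow> 'z) \<Rightarrow> bool" where
  "flow_factor G TG X actX Z actZ \<longleftrightarrow>
     flow G TG X actX \<and> flow G TG Z actZ \<and>
     (\<exists>f. continuous_map X Z f \<and> f ` topspace X = topspace Z \<and> equivariant G X actX actZ f)"


definition syndetic :: "('g, 'm) monoid_scheme \<Rightarrow> 'g topology \<Rightarrow> 'g set \<Rightarrow> bool" where
  "syndetic G TG A \<longleftrightarrow>
     A \<subseteq> carrier G \<and>
     (\<exists>K. K \<noteq> {} \<and> compactin TG K \<and> carrier G = (set_inv\<^bsub>G\<^esub> K) <#>\<^bsub>G\<^esub> A)"

definition uniformity_on_set :: "'z set \<Rightarrow> ('z \<times> 'z) set set \<Rightarrow> bool" where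
  "uniformity_on_set S \<U> \<longleftrightarrow>
     \<U> \<noteq> {} \<and>
     (\<forall>\<alpha> \<in> \<U>. Id_on S \<subseteq> \<alpha> \<and> \<alpha> \<subseteq> S \<times> S) \<and>
     (\<forall>\<alpha> \<in> \<U>. \<forall>\<beta>. \<alpha> \<subseteq> \<beta> \<and> \<beta> \<subseteq> S \<times> S \<longrightarrow> \<beta> \<in> \<U>) \<and>
     (\<forall>\<alpha> \<in> \<U>. \<forall>\<beta> \<in> \<U>. \<alpha> \<inter> \<beta> \<in> \<U>) \<and>
     (\<forall>\<alpha> \<in> \<U>. \<alpha>\<inverse> \<in> \<U>) \<and>
     (\<forall>\<alpha> \<in> \<U>. \<exists>\<beta> \<in> \<U>. \<beta> O \<beta> \<subseteq> \<alpha>)"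

definition uniformity_of_space :: "'z topology \<Rightarrow> ('z \<times> 'z) set set \<Rightarrow> bool" where
  "uniformity_of_space Z \<U> \<longleftrightarrow>
     uniformity_on_set (topspace Z) \<U> \<and>
     (\<forall>W. openin Z W \<longleftrightarrow> W \<subseteq> topspace Z \<and> (\<forall>z \<in> W. \<exists>\<alpha> \<in> \<U>. \<alpha> `` {z} \<subseteq> W))"

text \<open>A compact Hausdorff space carries exactly one compatible uniformity, so the existential
  quantifier over \<open>\<U>\<close> below just names it.\<close>

definition almost_periodic_flow ::
    "('g, 'm) monoid_scheme \<Rightarrow> 'g topology \<Rightarrow> 'z topology \<Rightarrow> ('g \<Rightarrow> 'z \<Rightarrow> 'z) \<Rightarrow> bool" where
  "almost_periodic_flow G TG Z act \<longleftrightarrow>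
     flow G TG Z act \<and> compact_space Z \<and> Hausdorff_space Z \<and>
     (\<exists>\<U>. uniformity_of_space Z \<U> \<and>
        (\<forall>\<alpha> \<in> \<U>. \<exists>A. syndetic G TG A \<and>
           (\<forall>z \<in> topspace Z. (\<lambda>t. act t z) ` A \<subseteq> \<alpha> `` {z})))"

end

theory Submission
  imports Defs
begin

text \<open>Let \<open>M\<close> be a minimal set of the subflow of \<open>H\<close>. By normality every translate \<open>tM\<close> is again
  \<open>H\<close>-minimal, and the union of the translates is closed because \<open>T/H\<close> is compact; by minimality of
  the flow it is \<open>X\<close>. So the \<open>H\<close>-orbit closures are the translates of \<open>M\<close>, they partition \<open>X\<close>, and
  the same compactness argument in \<open>X \<times> X\<close> shows that the partition is a closed relation. The quotient
  map to \<open>X/H\<close> is moreover open, so \<open>X/H\<close> is a compact Hausdorff flow, and the evaluation map is a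
  continuous bijection from a compact space onto it. Finally \<open>H\<close> acts trivially on \<open>X/H\<close>: if a
  neighbourhood \<open>U\<close> of the identity moves every point \<open>\<alpha>\<close>-little, so does \<open>UH\<close>, and finitely many
  translates of \<open>UH\<close> cover \<open>T\<close>.\<close>

section \<open>The uniformity of a compact Hausdorff space\<close>

text \<open>For compact Hausdorff \<open>Z\<close> this is the compatible uniformity. It is the
  witness for \<open>\<U>\<close> in \<open>almost_periodic_flow\<close>.\<close>

definition diagonal_nbhds :: "'z topology \<Rightarrow> ('z \<times> 'z) set set" where
  "diagonal_nbhds Z =
     {\<alpha>. \<alpha> \<subseteq> topspace Z \<times> topspace Z \<and>
          (\<exists>W. openin (prod_topology Z Z) W \<and> Id_on (topspace Z) \<subseteq> W \<and> W \<subseteq> \<alpha>)}"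

lemma openin_diagonal_nbhds:
  "openin (prod_topology Z Z) W \<Longrightarrow> Id_on (topspace Z) \<subseteq> W \<Longrightarrow> W \<in> diagonal_nbhds Z"
  using openin_subset[of "prod_topology Z Z" W] by (auto simp: diagonal_nbhds_def)

text \<open>By regularity, each point has an open \<open>P\<close> and a closed \<open>C\<close>
  with \<open>P \<subseteq> C \<subseteq> N\<close> and \<open>N \<times> N \<subseteq> W\<close>;
  by compactness finitely many \<open>P z\<close> cover \<open>Z\<close>. The root is built so that
  the middle point of a chain, lying in some \<open>P z\<close>, pulls both end points into
  \<open>N z\<close>.\<close>

lemma diagonal_nbhds_square_root:
  assumes "compact_space Z" "Hausdorff_space Z" "\<alpha> \<in> diagonal_nbhds Z"
  shows "\<exists>\<beta>\<in>diagonal_nbhds Z. \<beta> O \<beta> \<subseteq> \<alpha>"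
proof -
  obtain W where W: "openin (prod_topology Z Z) W" "Id_on (topspace Z) \<subseteq> W" "W \<subseteq> \<alpha>"
    using assms(3) by (auto simp: diagonal_nbhds_def)
  have "\<exists>N P C. openin Z N \<and> openin Z P \<and> closedin Z C \<and> z \<in> P \<and> P \<subseteq> C \<and> C \<subseteq> N \<and> N \<times> N \<subseteq> W"
    if z: "z \<in> topspace Z" for z
  proof -
    obtain U V where UV: "openin Z U" "openin Z V" "z \<in> U" "z \<in> V" "U \<times> V \<subseteq> W"
      using W z unfolding openin_prod_topology_alt by (metis Id_onI subsetD)
    have "regular_space Z"
      using assms compact_Hausdorff_imp_regular_space by blast
    then have "neighbourhood_base_of (closedin Z) Z"
      by (simp add: neighbourhood_base_of_closedin)
    moreover have "openin Z (U \<inter> V)" "z \<in> U \<inter> V" using UV by auto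
    ultimately obtain P C where "openin Z P" "closedin Z C" "z \<in> P" "P \<subseteq> C" "C \<subseteq> U \<inter> V"
      unfolding neighbourhood_base_of by metis
    then show ?thesis using UV by (intro exI[of _ "U \<inter> V"] exI[of _ P] exI[of _ C]) auto
  qed
  then obtain N P C where NPC: "\<And>z. z \<in> topspace Z \<Longrightarrow> openin Z (N z) \<and> openin Z (P z) \<and>
      closedin Z (C z) \<and> z \<in> P z \<and> P z \<subseteq> C z \<and> C z \<subseteq> N z \<and> N z \<times> N z \<subseteq> W"
    by metis
  have "\<exists>\<F>. finite \<F> \<and> \<F> \<subseteq> P ` topspace Z \<and> topspace Z \<subseteq> \<Union>\<F>"
    using assms(1) NPC unfolding compact_space_alt by (elim allE[of _ "P ` topspace Z"]) blast
  then obtain F where F: "finite F" "F \<subseteq> topspace Z" "topspace Z \<subseteq> (\<Union>z\<in>F. P z)"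
    by (metis finite_subset_image)
  \<comment> \<open>A pair in the z-th factor with one coordinate in \<open>C z\<close> has the
    other in \<open>N z\<close>. The factor \<open>topspace Z \<times> topspace Z\<close> keeps
    \<open>\<beta>\<close> inside the product and gives the right value when \<open>F\<close> is
    empty.\<close>
  define \<beta> where "\<beta> = (topspace Z \<times> topspace Z) \<inter>
     (\<Inter>z\<in>F. N z \<times> N z \<union> (topspace Z - C z) \<times> (topspace Z - C z))"
  have "openin (prod_topology Z Z) (topspace Z \<times> topspace Z)"
    by (simp add: openin_prod_Times_iff)
  moreover have "openin (prod_topology Z Z)
      (N z \<times> N z \<union> (topspace Z - C z) \<times> (topspace Z - C z))" if "z \<in> F" for z
    using NPC[OF subsetD[OF F(2) that]]
    by (intro openin_Un) (auto simp: openin_prod_Times_iff intro!: openin_diff)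
  ultimately have op: "openin (prod_topology Z Z) \<beta>"
    unfolding \<beta>_def using F(1)
    by (cases "F = {}") (auto intro!: openin_Int openin_Inter)
  moreover have "Id_on (topspace Z) \<subseteq> \<beta>"
  proof
    fix p assume "p \<in> Id_on (topspace Z)"
    then obtain z where z: "z \<in> topspace Z" "p = (z, z)" by auto
    then show "p \<in> \<beta>"
      using NPC[OF subsetD[OF F(2)]] by (auto simp: \<beta>_def)
  qed
  ultimately have "\<beta> \<in> diagonal_nbhds Z" by (rule openin_diagonal_nbhds)
  moreover have "\<beta> O \<beta> \<subseteq> W"
  proof clarify
    fix a b c assume ab: "(a, b) \<in> \<beta>" and bc: "(b, c) \<in> \<beta>"
    then have "b \<in> topspace Z" by (auto simp: \<beta>_def)
    then obtain z where z: "z \<in> F" "b \<in> P z" using F(3) by auto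
    then have "b \<in> C z" using NPC F(2) by blast
    then have "a \<in> N z" "c \<in> N z" using ab bc z(1) by (auto simp: \<beta>_def)
    then show "(a, c) \<in> W" using NPC F(2) z(1) by blast
  qed
  ultimately show ?thesis using W(3) by blast
qed

lemma uniformity_on_set_diagonal_nbhds:
  assumes "compact_space Z" "Hausdorff_space Z"
  shows "uniformity_on_set (topspace Z) (diagonal_nbhds Z)"
  unfolding uniformity_on_set_def
proof (intro conjI ballI allI impI)
  have "topspace Z \<times> topspace Z \<in> diagonal_nbhds Z"
    by (intro openin_diagonal_nbhds) (auto simp: openin_prod_Times_iff)
  then show "diagonal_nbhds Z \<noteq> {}" by blast
next
  fix \<alpha> \<beta> assume \<alpha>: "\<alpha> \<in> diagonal_nbhds Z" and \<beta>: "\<beta> \<in> diagonal_nbhds Z"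
  obtain V W where "openin (prod_topology Z Z) V" "Id_on (topspace Z) \<subseteq> V" "V \<subseteq> \<alpha>"
    "openin (prod_topology Z Z) W" "Id_on (topspace Z) \<subseteq> W" "W \<subseteq> \<beta>"
    using \<alpha> \<beta> by (auto simp: diagonal_nbhds_def)
  then have "openin (prod_topology Z Z) (V \<inter> W) \<and> Id_on (topspace Z) \<subseteq> V \<inter> W \<and> V \<inter> W \<subseteq> \<alpha> \<inter> \<beta>"
    by auto
  then show "\<alpha> \<inter> \<beta> \<in> diagonal_nbhds Z"
    using \<alpha> unfolding diagonal_nbhds_def by blast
next
  fix \<alpha> assume \<alpha>: "\<alpha> \<in> diagonal_nbhds Z"
  then obtain W where W: "openin (prod_topology Z Z) W" "Id_on (topspace Z) \<subseteq> W" "W \<subseteq> \<alpha>"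
    by (auto simp: diagonal_nbhds_def)
  have "openin (prod_topology Z Z) (W\<inverse>)"
    unfolding openin_prod_topology_alt
  proof (intro allI impI)
    fix a b assume "(a, b) \<in> W\<inverse>"
    then obtain U V where "openin Z U" "openin Z V" "b \<in> U" "a \<in> V" "U \<times> V \<subseteq> W"
      using W(1) unfolding openin_prod_topology_alt by (metis converseD)
    then show "\<exists>U V. openin Z U \<and> openin Z V \<and> a \<in> U \<and> b \<in> V \<and> U \<times> V \<subseteq> W\<inverse>" by blast
  qed
  moreover have "Id_on (topspace Z) \<subseteq> W\<inverse>" "W\<inverse> \<subseteq> \<alpha>\<inverse>" using W by auto
  moreover have "\<alpha>\<inverse> \<subseteq> topspace Z \<times> topspace Z" using \<alpha> by (auto simp: diagonal_nbhds_def)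
  ultimately show "\<alpha>\<inverse> \<in> diagonal_nbhds Z" unfolding diagonal_nbhds_def by blast
next
  fix \<alpha> \<beta>
  assume "\<alpha> \<in> diagonal_nbhds Z" "\<alpha> \<subseteq> \<beta> \<and> \<beta> \<subseteq> topspace Z \<times> topspace Z"
  then show "\<beta> \<in> diagonal_nbhds Z" unfolding diagonal_nbhds_def by blast
next
  fix \<alpha> assume "\<alpha> \<in> diagonal_nbhds Z"
  then show "\<exists>\<beta>\<in>diagonal_nbhds Z. \<beta> O \<beta> \<subseteq> \<alpha>" by (rule diagonal_nbhds_square_root[OF assms])
qed (auto simp: diagonal_nbhds_def)

lemma uniformity_of_space_diagonal_nbhds:
  assumes "compact_space Z" "Hausdorff_space Z"
  shows "uniformity_of_space Z (diagonal_nbhds Z)"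
  unfolding uniformity_of_space_def
proof (intro conjI allI uniformity_on_set_diagonal_nbhds assms iffI)
  fix S assume S: "openin Z S"
  then show "S \<subseteq> topspace Z" by (rule openin_subset)
  show "\<forall>z\<in>S. \<exists>\<alpha>\<in>diagonal_nbhds Z. \<alpha> `` {z} \<subseteq> S"
  proof
    fix z assume z: "z \<in> S"
    then have "z \<in> topspace Z" using S openin_subset by blast
    then have "closedin Z {z}" using assms(2) by (simp add: closedin_Hausdorff_singleton)
    \<comment> \<open>This open set contains the diagonal, and its section at \<open>z\<close> is
      exactly \<open>S\<close>: the second rectangle fills in the rest of the diagonal without
      touching the fibre over \<open>z\<close>.\<close>
    then have "openin (prod_topology Z Z) (S \<times> S \<union> (topspace Z - {z}) \<times> topspace Z)"
      using S by (intro openin_Un) (auto simp: openin_prod_Times_iff)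
    then have "S \<times> S \<union> (topspace Z - {z}) \<times> topspace Z \<in> diagonal_nbhds Z"
      using z by (intro openin_diagonal_nbhds) auto
    moreover have "(S \<times> S \<union> (topspace Z - {z}) \<times> topspace Z) `` {z} \<subseteq> S" by auto
    ultimately show "\<exists>\<alpha>\<in>diagonal_nbhds Z. \<alpha> `` {z} \<subseteq> S" by blast
  qed
next
  fix S assume S: "S \<subseteq> topspace Z \<and> (\<forall>z\<in>S. \<exists>\<alpha>\<in>diagonal_nbhds Z. \<alpha> `` {z} \<subseteq> S)"
  show "openin Z S"
  proof (subst openin_subopen, intro ballI)
    fix z assume z: "z \<in> S"
    then obtain \<alpha> where \<alpha>: "\<alpha> \<in> diagonal_nbhds Z" "\<alpha> `` {z} \<subseteq> S" using S by meson
    then obtain W where W: "openin (prod_topology Z Z) W" "Id_on (topspace Z) \<subseteq> W" "W \<subseteq> \<alpha>"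
      unfolding diagonal_nbhds_def by blast
    have "(z, z) \<in> W" using S z W(2) by blast
    then obtain U V where "openin Z U" "openin Z V" "z \<in> U" "z \<in> V" "U \<times> V \<subseteq> W"
      using W(1) unfolding openin_prod_topology_alt by meson
    with \<alpha>(2) W(3) show "\<exists>T. openin Z T \<and> z \<in> T \<and> T \<subseteq> S" by blast
  qed
qed


section \<open>Open quotients\<close>

text \<open>A pair of inequivalent points has a box \<open>U \<times> V\<close> missing the closed
  kernel relation. The images of \<open>U\<close> and \<open>V\<close> are then disjoint, and they
  are open because \<open>q\<close> is an open map.\<close>

lemma Hausdorff_space_open_quotient:
  assumes q: "quotient_map X Z q" and op: "open_map X Z q"
    and cl: "closedin (prod_topology X X) {(x, y). x \<in> topspace X \<and> y \<in> topspace X \<and> q x = q y}"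
  shows "Hausdorff_space Z"
  unfolding Hausdorff_space_def
proof (intro allI impI, elim conjE)
  fix a b assume ab: "a \<in> topspace Z" "b \<in> topspace Z" "a \<noteq> b"
  have im: "q ` topspace X = topspace Z" using q by (simp add: quotient_map_def)
  then obtain x y where xy: "x \<in> topspace X" "y \<in> topspace X" "a = q x" "b = q y" using ab by blast
  let ?R = "{(x, y). x \<in> topspace X \<and> y \<in> topspace X \<and> q x = q y}"
  have "openin (prod_topology X X) (topspace X \<times> topspace X - ?R)"
    using cl by (simp add: closedin_def)
  moreover have "(x, y) \<in> topspace X \<times> topspace X - ?R" using xy ab by auto
  ultimately obtain U V where UV: "openin X U" "openin X V" "x \<in> U" "y \<in> V"
      "U \<times> V \<subseteq> topspace X \<times> topspace X - ?R"
    unfolding openin_prod_topology_alt by meson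
  have "openin Z (q ` U)" "openin Z (q ` V)" using op UV by (auto simp: open_map_def)
  moreover have "a \<in> q ` U" "b \<in> q ` V" using UV xy by auto
  moreover have "disjnt (q ` U) (q ` V)" using UV(5) unfolding disjnt_def by blast
  ultimately show "\<exists>U V. openin Z U \<and> openin Z V \<and> a \<in> U \<and> b \<in> V \<and> disjnt U V" by blast
qed

text \<open>The point is joint continuity. A product of the identity with a quotient map need not be
  a quotient map, but with an open surjection it is again an open surjection, so continuity descends
  along it. This yields both the flow on a coset space and the flow on X/H.\<close>

lemma flow_open_quotient:
  assumes G: "monoid G" and fl: "flow G TG Y a" and T: "topspace TG = carrier G"
    and p: "continuous_map Y Z p" "open_map Y Z p" "p ` topspace Y = topspace Z"
    and eqv: "equivariant G Y a b p"
  shows "flow G TG Z b"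
proof -
  have ca: "continuous_map (prod_topology TG Y) Y (\<lambda>(t, x). a t x)"
    and a1: "\<And>y. y \<in> topspace Y \<Longrightarrow> a \<one>\<^bsub>G\<^esub> y = y"
    and am: "\<And>s t y. s \<in> carrier G \<Longrightarrow> t \<in> carrier G \<Longrightarrow> y \<in> topspace Y \<Longrightarrow>
        a (s \<otimes>\<^bsub>G\<^esub> t) y = a s (a t y)"
    using fl by (auto simp: flow_def)
  have a_in: "a t y \<in> topspace Y" if "t \<in> carrier G" "y \<in> topspace Y" for t y
    using ca that T by (force simp: continuous_map_def)
  have pa: "p (a t y) = b t (p y)" if "t \<in> carrier G" "y \<in> topspace Y" for t y
    using eqv that by (auto simp: equivariant_def)
  have mult_in: "s \<otimes>\<^bsub>G\<^esub> t \<in> carrier G" if "s \<in> carrier G" "t \<in> carrier G" for s t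
    using G that by (rule monoid.m_closed)
  show ?thesis unfolding flow_def
  proof (intro conjI ballI)
    let ?P = "\<lambda>(t, y). (t, p y)"
    have "continuous_map (prod_topology TG Y) (prod_topology TG Z) ?P"
      unfolding case_prod_unfold
      by (intro continuous_map_pairedI continuous_map_fst continuous_map_compose[OF continuous_map_snd p(1), unfolded o_def])
    moreover have "open_map (prod_topology TG Y) (prod_topology TG Z) ?P"
      unfolding open_map_def
    proof (intro allI impI)
      fix W assume W: "openin (prod_topology TG Y) W"
      show "openin (prod_topology TG Z) (?P ` W)"
        unfolding openin_prod_topology_alt
      proof (intro allI impI)
        fix t z assume "(t, z) \<in> ?P ` W"
        then obtain y where y: "(t, y) \<in> W" "z = p y" by auto
        then obtain U V where "openin TG U" "openin Y V" "t \<in> U" "y \<in> V" "U \<times> V \<subseteq> W"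
          using W unfolding openin_prod_topology_alt by meson
        then show "\<exists>U V. openin TG U \<and> openin Z V \<and> t \<in> U \<and> z \<in> V \<and> U \<times> V \<subseteq> ?P ` W"
          using p(2) y(2) unfolding open_map_def
          by (intro exI[of _ U] exI[of _ "p ` V"]) force
      qed
    qed
    moreover have "?P ` topspace (prod_topology TG Y) = topspace (prod_topology TG Z)"
      using p(3) by force
    ultimately have "quotient_map (prod_topology TG Y) (prod_topology TG Z) ?P"
      by (rule continuous_open_imp_quotient_map)
    moreover have "continuous_map (prod_topology TG Y) Z ((\<lambda>(t, z). b t z) \<circ> ?P)"
    proof (rule continuous_map_eq[OF continuous_map_compose[OF ca p(1)]])
      show "(p \<circ> (\<lambda>(t, x). a t x)) w = ((\<lambda>(t, z). b t z) \<circ> ?P) w"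
        if "w \<in> topspace (prod_topology TG Y)" for w
        using that T pa by auto
    qed
    ultimately show "continuous_map (prod_topology TG Z) Z (\<lambda>(t, z). b t z)"
      by (rule continuous_compose_quotient_map)
  next
    fix z assume "z \<in> topspace Z"
    then show "b \<one>\<^bsub>G\<^esub> z = z" using p(3) pa a1 monoid.one_closed[OF G] by (metis imageE)
  next
    fix s t z assume st: "s \<in> carrier G" "t \<in> carrier G" and "z \<in> topspace Z"
    then obtain y where y: "y \<in> topspace Y" "z = p y" using p(3) by auto
    have "b (s \<otimes>\<^bsub>G\<^esub> t) z = p (a (s \<otimes>\<^bsub>G\<^esub> t) y)" using pa[OF mult_in] st y by simp
    also have "\<dots> = b s (b t z)" using am pa a_in st y by simp
    finally show "b (s \<otimes>\<^bsub>G\<^esub> t) z = b s (b t z)" .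
  qed
qed


section \<open>Coset spaces of a topological group\<close>

lemma (in group) l_coset_eq_iff:
  assumes "subgroup H G" "s \<in> carrier G" "t \<in> carrier G"
  shows "s <# H = t <# H \<longleftrightarrow> inv s \<otimes> t \<in> H"
proof
  assume "s <# H = t <# H"
  then have "t \<in> s <# H"
    using assms by (auto simp: l_coset_def intro!: bexI[of _ \<one>] subgroup.one_closed)
  then show "inv s \<otimes> t \<in> H"
    using assms by (auto simp: l_coset_def inv_solve_left subgroup.mem_carrier[OF assms(1)] m_assoc[symmetric])
next
  assume h: "inv s \<otimes> t \<in> H"
  have "t \<in> s <# H"
    unfolding l_coset_def using assms h
    by (auto intro!: bexI[OF _ h] simp: m_assoc[symmetric])
  then show "s <# H = t <# H"
    using assms by (intro l_repr_independence)
qed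

context topological_group
begin

lemma continuous_map_mult_right:
  assumes "h \<in> carrier G"
  shows "continuous_map TG TG (\<lambda>t. t \<otimes> h)"
proof -
  have "continuous_map TG (prod_topology TG TG) (\<lambda>t. (t, h))"
    using assms by (intro continuous_map_pairedI) (auto simp: topspace_eq_carrier)
  from continuous_map_compose[OF this continuous_mult] show ?thesis by (simp add: o_def)
qed

lemma continuous_map_mult_left:
  assumes "s \<in> carrier G"
  shows "continuous_map TG TG (\<lambda>t. s \<otimes> t)"
proof -
  have "continuous_map TG (prod_topology TG TG) (\<lambda>t. (s, t))"
    using assms by (intro continuous_map_pairedI) (auto simp: topspace_eq_carrier)
  from continuous_map_compose[OF this continuous_mult] show ?thesis by (simp add: o_def)
qed

lemma openin_r_coset:
  assumes U: "openin TG U" and h: "h \<in> carrier G"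
  shows "openin TG (U #> h)"
proof -
  have sub: "U \<subseteq> carrier G" using openin_subset[OF U] by (simp add: topspace_eq_carrier)
  have "U #> h = {t \<in> topspace TG. t \<otimes> inv h \<in> U}"
  proof (intro equalityI subsetI)
    fix t assume "t \<in> U #> h"
    then obtain u where u: "u \<in> U" "t = u \<otimes> h" by (auto simp: r_coset_def)
    moreover have "u \<in> carrier G" using u sub by blast
    ultimately show "t \<in> {t \<in> topspace TG. t \<otimes> inv h \<in> U}"
      using h by (simp add: topspace_eq_carrier m_assoc)
  next
    fix t assume "t \<in> {t \<in> topspace TG. t \<otimes> inv h \<in> U}"
    then have t: "t \<in> carrier G" "t \<otimes> inv h \<in> U" by (auto simp: topspace_eq_carrier)
    have "t = t \<otimes> inv h \<otimes> h" using t(1) h by (simp add: m_assoc)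
    with t(2) show "t \<in> U #> h" unfolding r_coset_def by blast
  qed
  then show ?thesis
    using openin_continuous_map_preimage[OF continuous_map_mult_right U] h by simp
qed

lemma openin_set_mult:
  assumes "openin TG U" "H \<subseteq> carrier G"
  shows "openin TG (U <#> H)"
proof -
  have "U <#> H = (\<Union>h\<in>H. U #> h)" by (auto simp: set_mult_def r_coset_def)
  moreover have "openin TG (\<Union>h\<in>H. U #> h)"
    using assms openin_r_coset by (intro openin_Union) blast
  ultimately show ?thesis by simp
qed

lemma topspace_left_coset_space:
  "topspace (left_coset_space G TG H) = (\<lambda>t. t <# H) ` carrier G"
  by (simp add: left_coset_space_def topspace_quotient_topology topspace_eq_carrier)

lemma quotient_map_l_coset: "quotient_map TG (left_coset_space G TG H) (\<lambda>t. t <# H)"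
  unfolding left_coset_space_def by (rule quotient_map_quotient_topology)

text \<open>The saturation of an open \<open>U\<close> is \<open>U <#> H\<close>, a union of right
  translates of \<open>U\<close>, hence open.\<close>

lemma open_map_l_coset:
  assumes H: "subgroup H G"
  shows "open_map TG (left_coset_space G TG H) (\<lambda>t. t <# H)"
  unfolding open_map_def
proof (intro allI impI)
  fix U assume U: "openin TG U"
  have sub: "U \<subseteq> carrier G" using openin_subset[OF U] by (simp add: topspace_eq_carrier)
  note Hc = subgroup.subset[OF H]
  have "{t \<in> topspace TG. t <# H \<in> (\<lambda>t. t <# H) ` U} = U <#> H"
  proof (intro equalityI subsetI)
    fix t assume "t \<in> {t \<in> topspace TG. t <# H \<in> (\<lambda>t. t <# H) ` U}"
    then obtain u where u: "u \<in> U" "u <# H = t <# H" "t \<in> carrier G"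
      by (auto simp: topspace_eq_carrier)
    then have "inv u \<otimes> t \<in> H" using l_coset_eq_iff[OF H, of u t] sub by blast
    moreover have "t = u \<otimes> (inv u \<otimes> t)"
      using u sub by (simp add: m_assoc[symmetric] subsetD)
    ultimately show "t \<in> U <#> H" using u(1) unfolding set_mult_def by blast
  next
    fix t assume "t \<in> U <#> H"
    then obtain u h where u: "u \<in> U" "h \<in> H" "t = u \<otimes> h" by (auto simp: set_mult_def)
    then have c: "u \<in> carrier G" "h \<in> carrier G" using sub Hc by auto
    then have "inv u \<otimes> t = h" using u(3) by (simp add: m_assoc[symmetric])
    then have "u <# H = t <# H" using l_coset_eq_iff[OF H, of u t] c u by simp
    then show "t \<in> {t \<in> topspace TG. t <# H \<in> (\<lambda>t. t <# H) ` U}"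
      using c u by (auto simp: topspace_eq_carrier)
  qed
  then show "openin (left_coset_space G TG H) ((\<lambda>t. t <# H) ` U)"
    using openin_set_mult[OF U Hc] sub
    by (simp add: left_coset_space_def openin_quotient_topology topspace_eq_carrier image_mono)
qed

text \<open>The images of the sets \<open>U t\<close> form an open cover of the compact coset space;
  pulling a finite subcover back to the group replaces each \<open>U t\<close> by its saturation.
  Both the closed projection below and the syndeticity argument use co-compactness in this
  form.\<close>

lemma cocompact_finite_cover:
  assumes H: "subgroup H G" and co: "compact_space (left_coset_space G TG H)"
    and U: "\<And>t. t \<in> carrier G \<Longrightarrow> openin TG (U t) \<and> t \<in> U t"
  obtains F where "finite F" "F \<subseteq> carrier G" "carrier G = (\<Union>t\<in>F. U t <#> H)"
proof -
  let ?p = "\<lambda>t. t <# H"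
  let ?c = "(\<lambda>t. ?p ` U t) ` carrier G"
  have "\<forall>V\<in>?c. openin (left_coset_space G TG H) V"
    using open_map_l_coset[OF H] U by (auto simp: open_map_def)
  moreover have "topspace (left_coset_space G TG H) \<subseteq> \<Union>?c"
    using U by (auto simp: topspace_left_coset_space)
  ultimately obtain \<F> where "finite \<F>" "\<F> \<subseteq> ?c" "topspace (left_coset_space G TG H) \<subseteq> \<Union>\<F>"
    using co unfolding compact_space_alt by meson
  then obtain F where F: "finite F" "F \<subseteq> carrier G"
      "?p ` carrier G \<subseteq> (\<Union>t\<in>F. ?p ` U t)"
    by (metis finite_subset_image topspace_left_coset_space)
  have Uc: "U t \<subseteq> carrier G" if "t \<in> F" for t
    using openin_subset U F(2) that topspace_eq_carrier by blast
  have "carrier G = (\<Union>t\<in>F. U t <#> H)"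
  proof
    show "(\<Union>t\<in>F. U t <#> H) \<subseteq> carrier G"
      using setmult_subset_G[OF Uc subgroup.subset[OF H]] by blast
    show "carrier G \<subseteq> (\<Union>t\<in>F. U t <#> H)"
    proof
      fix s assume s: "s \<in> carrier G"
      then obtain t u where t: "t \<in> F" "u \<in> U t" "s <# H = u <# H" using F(3) by blast
      then have u: "u \<in> carrier G" using Uc by blast
      then have "inv u \<otimes> s \<in> H" using l_coset_eq_iff[OF H u s] t by simp
      moreover have "s = u \<otimes> (inv u \<otimes> s)" using u s by (simp add: m_assoc[symmetric])
      ultimately show "s \<in> (\<Union>t\<in>F. U t <#> H)" using t unfolding set_mult_def by blast
    qed
  qed
  with F show ?thesis by (intro that)
qed

text \<open>T/K is a continuous image of T/H. This is needed for the envelope, which contains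
  \<open>H\<close>.\<close>

lemma compact_left_coset_space_mono:
  assumes H: "subgroup H G" and K: "subgroup K G" and sub: "H \<subseteq> K"
    and co: "compact_space (left_coset_space G TG H)"
  shows "compact_space (left_coset_space G TG K)"
proof -
  \<comment> \<open>Multiplying a coset of \<open>H\<close> by \<open>K\<close> gives the coset of
    \<open>K\<close> containing it, so no representative has to be chosen.\<close>
  let ?j = "\<lambda>C. C <#> K"
  have j: "(t <# H) <#> K = t <# K" if t: "t \<in> carrier G" for t
  proof -
    have "H <#> K = K"
    proof
      show "H <#> K \<subseteq> K" using sub by (auto simp: set_mult_def subgroup.m_closed[OF K])
      show "K \<subseteq> H <#> K"
        using subgroup.one_closed[OF H] subgroup.mem_carrier[OF K]
        unfolding set_mult_def by (force intro: bexI[of _ \<one>])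
    qed
    then show ?thesis
      using t subgroup.subset[OF H] subgroup.subset[OF K]
      by (simp add: l_coset_eq_set_mult set_mult_assoc)
  qed
  have "continuous_map TG (left_coset_space G TG K) (?j \<circ> (\<lambda>t. t <# H))"
    by (rule continuous_map_eq[OF quotient_imp_continuous_map[OF quotient_map_l_coset]])
      (simp add: j topspace_eq_carrier)
  then have "continuous_map (left_coset_space G TG H) (left_coset_space G TG K) ?j"
    by (rule continuous_compose_quotient_map[OF quotient_map_l_coset])
  moreover have "?j ` topspace (left_coset_space G TG H) = topspace (left_coset_space G TG K)"
    unfolding topspace_left_coset_space image_image using j by (intro image_cong) auto
  ultimately show ?thesis using co image_compactin unfolding compact_space_def by metis
qed

text \<open>The projection along the compact space \<open>T/H\<close> is a closed map.\<close>

lemma closedin_cocompact_projection: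
  assumes H: "subgroup H G" and co: "compact_space (left_coset_space G TG H)"
    and C: "closedin (prod_topology TG Y) C"
    and sat: "\<And>t h y. (t, y) \<in> C \<Longrightarrow> h \<in> H \<Longrightarrow> (t \<otimes> h, y) \<in> C"
  shows "closedin Y (snd ` C)"
  unfolding closedin_def
proof
  have Csub: "C \<subseteq> carrier G \<times> topspace Y"
    using closedin_subset[OF C] by (simp add: topspace_eq_carrier)
  then show "snd ` C \<subseteq> topspace Y" by auto
  show "openin Y (topspace Y - snd ` C)"
  proof (subst openin_subopen, intro ballI)
    fix y assume y: "y \<in> topspace Y - snd ` C"
    have "\<exists>U V. openin TG U \<and> openin Y V \<and> t \<in> U \<and> y \<in> V \<and> U \<times> V \<inter> C = {}"
      if t: "t \<in> carrier G" for t
    proof -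
      have "(t, y) \<in> topspace (prod_topology TG Y) - C"
        using t y by (force simp: topspace_eq_carrier)
      moreover have "openin (prod_topology TG Y) (topspace (prod_topology TG Y) - C)"
        using C by (rule openin_diff[OF openin_topspace])
      ultimately show ?thesis unfolding openin_prod_topology_alt by (meson Diff_disjoint disjoint_iff subsetD DiffD2)
    qed
    then obtain U V where UV: "\<And>t. t \<in> carrier G \<Longrightarrow> openin TG (U t) \<and> openin Y (V t) \<and>
        t \<in> U t \<and> y \<in> V t \<and> U t \<times> V t \<inter> C = {}"
      by metis
    obtain F where F: "finite F" "F \<subseteq> carrier G" "carrier G = (\<Union>t\<in>F. U t <#> H)"
      using cocompact_finite_cover[OF H co, of U] UV by metis
    \<comment> \<open>As in the tube lemma, the boxes around the points (t, y) miss
      \<open>C\<close>, and finitely many sets \<open>U t <#> H\<close> cover the group.\<close>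
    let ?V = "topspace Y \<inter> (\<Inter>t\<in>F. V t)"
    have "openin Y (V t)" if "t \<in> F" for t using UV F(2) that by blast
    then have "openin Y ?V"
      using F(1) by (cases "F = {}") (auto intro!: openin_Int openin_Inter)
    moreover have "y \<in> ?V" using y UV F(2) by blast
    moreover have "?V \<subseteq> topspace Y - snd ` C"
    proof
      fix z assume z: "z \<in> ?V"
      have "(s, z) \<notin> C" for s
      proof
        assume s: "(s, z) \<in> C"
        then have "s \<in> carrier G" using Csub by blast
        then obtain t u h where t: "t \<in> F" "u \<in> U t" "h \<in> H" "s = u \<otimes> h"
          using F(3) by (auto simp: set_mult_def)
        have tc: "t \<in> carrier G" using t F(2) by blast
        then have "u \<in> carrier G" using UV openin_subset t topspace_eq_carrier by blast
        \<comment> \<open>Saturation compensates for covering only by \<open>U t <#> H\<close>: a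
          point of \<open>C\<close> over \<open>z\<close> can be moved by \<open>H\<close> until its
          group coordinate lies in \<open>U t\<close> itself, where the box excludes it.\<close>
        then have "s \<otimes> inv h = u" using t subgroup.mem_carrier[OF H] by (simp add: m_assoc)
        then have "(u, z) \<in> C" using sat[OF s subgroup.m_inv_closed[OF H t(3)]] by simp
        moreover have "(u, z) \<in> U t \<times> V t" using z t by auto
        ultimately show False using UV[OF tc] by blast
      qed
      then show "z \<in> topspace Y - snd ` C" using z by auto
    qed
    ultimately show "\<exists>T. openin Y T \<and> y \<in> T \<and> T \<subseteq> topspace Y - snd ` C" by blast
  qed
qed

lemma flow_left_mult: "flow G TG TG (\<lambda>s t. s \<otimes> t)"
  unfolding flow_def using continuous_mult by (auto simp: topspace_eq_carrier m_assoc)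

lemma flow_left_coset_space:
  assumes H: "subgroup H G"
  shows "flow G TG (left_coset_space G TG H) (\<lambda>s C. s <# C)"
proof (rule flow_open_quotient[OF is_monoid flow_left_mult topspace_eq_carrier])
  show "continuous_map TG (left_coset_space G TG H) (\<lambda>t. t <# H)"
    by (rule quotient_imp_continuous_map[OF quotient_map_l_coset])
  show "open_map TG (left_coset_space G TG H) (\<lambda>t. t <# H)" by (rule open_map_l_coset[OF H])
  show "(\<lambda>t. t <# H) ` topspace TG = topspace (left_coset_space G TG H)"
    by (simp add: topspace_left_coset_space topspace_eq_carrier)
  show "equivariant G TG (\<lambda>s t. s \<otimes> t) (\<lambda>s C. s <# C) (\<lambda>t. t <# H)"
    using subgroup.subset[OF H] by (simp add: equivariant_def topspace_eq_carrier lcos_m_assoc)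
qed

end


section \<open>Orbit closures of a normal subgroup\<close>

locale flow_system = topological_group G TG for G (structure) and TG +
  fixes X :: "'x topology" and act :: "'a \<Rightarrow> 'x \<Rightarrow> 'x"
  assumes flow: "flow G TG X act"
begin

section \<open>Homeomorphisms and orbit maps of a flow\<close>

lemma continuous_act: "continuous_map (prod_topology TG X) X (\<lambda>(t, x). act t x)"
  and act_one: "x \<in> topspace X \<Longrightarrow> act \<one> x = x"
  and act_mult: "s \<in> carrier G \<Longrightarrow> t \<in> carrier G \<Longrightarrow> x \<in> topspace X \<Longrightarrow>
     act (s \<otimes> t) x = act s (act t x)"
  using flow by (auto simp: flow_def)

lemma act_closed: "t \<in> carrier G \<Longrightarrow> x \<in> topspace X \<Longrightarrow> act t x \<in> topspace X"
  using continuous_act by (force simp: continuous_map_def topspace_eq_carrier)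

lemma act_inv_act: "t \<in> carrier G \<Longrightarrow> x \<in> topspace X \<Longrightarrow> act (inv t) (act t x) = x"
  and act_act_inv: "t \<in> carrier G \<Longrightarrow> x \<in> topspace X \<Longrightarrow> act t (act (inv t) x) = x"
  by (simp_all flip: act_mult add: act_one)

lemma continuous_map_act:
  assumes "t \<in> carrier G"
  shows "continuous_map X X (act t)"
proof -
  have "continuous_map X (prod_topology TG X) (\<lambda>x. (t, x))"
    using assms by (intro continuous_map_pairedI) (auto simp: topspace_eq_carrier)
  from continuous_map_compose[OF this continuous_act] show ?thesis by (simp add: o_def)
qed

lemma continuous_map_orbit:
  assumes "x \<in> topspace X"
  shows "continuous_map TG X (\<lambda>t. act t x)"
proof -
  have "continuous_map TG (prod_topology TG X) (\<lambda>t. (t, x))"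
    using assms by (intro continuous_map_pairedI) auto
  from continuous_map_compose[OF this continuous_act] show ?thesis by (simp add: o_def)
qed

lemma continuous_map_inv_act:
  "continuous_map (prod_topology TG X) X (\<lambda>(t, x). act (inv t) x)"
proof -
  have "continuous_map (prod_topology TG X) (prod_topology TG X) (\<lambda>p. (inv (fst p), snd p))"
    by (intro continuous_map_pairedI continuous_map_snd
        continuous_map_compose[OF continuous_map_fst continuous_inv, unfolded o_def])
  from continuous_map_compose[OF this continuous_act] show ?thesis
    by (simp add: o_def case_prod_unfold)
qed

lemma homeomorphic_map_act:
  assumes "t \<in> carrier G"
  shows "homeomorphic_map X X (act t)"
  unfolding homeomorphic_map_maps homeomorphic_maps_def
  using assms continuous_map_act act_inv_act act_act_inv inv_closed by blast

lemma openin_act_image: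
  "t \<in> carrier G \<Longrightarrow> openin X U \<Longrightarrow> openin X (act t ` U)"
  using homeomorphic_imp_open_map[OF homeomorphic_map_act] by (simp add: open_map_def)

section \<open>Orbit closures and minimal sets\<close>

lemma orbit_closure_subset: "orbit_closure X act S x \<subseteq> topspace X"
  and closedin_orbit_closure: "closedin X (orbit_closure X act S x)"
  by (simp_all add: orbit_closure_def closure_of_subset_topspace)

lemma mem_orbit_closure_self:
  assumes "subgroup H G" "x \<in> topspace X"
  shows "x \<in> orbit_closure X act H x"
proof -
  have "x \<in> (\<lambda>t. act t x) ` H"
    using assms act_one subgroup.one_closed by (metis image_eqI)
  moreover have "(\<lambda>t. act t x) ` H \<subseteq> topspace X"
    using assms(2) act_closed subgroup.mem_carrier[OF assms(1)] by auto
  ultimately show ?thesis unfolding orbit_closure_def by (rule rev_subsetD[OF _ closure_of_subset])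
qed

lemma orbit_closure_minimal:
  assumes "closedin X C" "x \<in> C" "\<And>t y. t \<in> S \<Longrightarrow> y \<in> C \<Longrightarrow> act t y \<in> C"
  shows "orbit_closure X act S x \<subseteq> C"
  unfolding orbit_closure_def using assms by (intro closure_of_minimal) auto

lemma orbit_closure_act:
  assumes H: "subgroup H G" and h: "h \<in> H" and x: "x \<in> topspace X"
  shows "orbit_closure X act H (act h x) = orbit_closure X act H x"
proof -
  note Hc = subgroup.mem_carrier[OF H]
  have "(\<lambda>t. act t (act h x)) ` H = (\<lambda>t. act t x) ` H"
  proof (intro equalityI image_subsetI)
    fix t assume t: "t \<in> H"
    have "act t (act h x) = act (t \<otimes> h) x" using t h x Hc by (simp add: act_mult)
    then show "act t (act h x) \<in> (\<lambda>t. act t x) ` H"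
      using subgroup.m_closed[OF H t h] by blast
    have "act t x = act (t \<otimes> inv h) (act h x)"
      using t h x Hc by (simp add: m_assoc flip: act_mult)
    then show "act t x \<in> (\<lambda>t. act t (act h x)) ` H"
      using subgroup.m_closed[OF H t subgroup.m_inv_closed[OF H h]] by blast
  qed
  then show ?thesis by (simp add: orbit_closure_def)
qed

text \<open>Normality gives tH = Ht, so t maps the orbit Hx onto the orbit H(tx); being a
  homeomorphism, it commutes with closure.\<close>

lemma act_image_orbit_closure:
  assumes H: "H \<lhd> G" and t: "t \<in> carrier G" and x: "x \<in> topspace X"
  shows "act t ` orbit_closure X act H x = orbit_closure X act H (act t x)"
proof -
  interpret N: normal H G by (rule H)
  have tH: "(\<lambda>h. h \<otimes> t) ` H = (\<lambda>h. t \<otimes> h) ` H"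
    using N.coset_eq t by (auto simp: l_coset_def r_coset_def UNION_singleton_eq_range)
  have "act t ` (\<lambda>h. act h x) ` H = (\<lambda>s. act s x) ` (\<lambda>h. t \<otimes> h) ` H"
    unfolding image_image using t x by (intro image_cong) (auto simp: act_mult N.mem_carrier)
  also have "\<dots> = (\<lambda>h. act h (act t x)) ` H"
    unfolding tH[symmetric] image_image using t x
    by (intro image_cong) (auto simp: act_mult N.mem_carrier)
  finally have eq: "act t ` (\<lambda>h. act h x) ` H = (\<lambda>h. act h (act t x)) ` H" .
  have "(\<lambda>h. act h x) ` H \<subseteq> topspace X" using x act_closed N.mem_carrier by blast
  from homeomorphic_map_closure_of[OF homeomorphic_map_act[OF t] this]
  show ?thesis unfolding orbit_closure_def eq by simp
qed

text \<open>The element \<open>h\<close> carries the orbit closure of \<open>x\<close> onto that of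
  hx, and the orbits of hx and \<open>x\<close> under \<open>H\<close> coincide.\<close>

lemma orbit_closure_invariant:
  assumes "H \<lhd> G" "h \<in> H" "x \<in> topspace X" "y \<in> orbit_closure X act H x"
  shows "act h y \<in> orbit_closure X act H x"
proof -
  have H: "subgroup H G" using assms(1) by (rule normal_imp_subgroup)
  then have "act h ` orbit_closure X act H x = orbit_closure X act H x"
    using act_image_orbit_closure[of H h x] orbit_closure_act[OF H, of h x] assms
      subgroup.mem_carrier by metis
  then show ?thesis using assms(4) by blast
qed

text \<open>Zorn's lemma is applied to complements: a maximal proper open set with
  \<open>H\<close>-invariant complement has a minimal invariant closed complement.\<close>

lemma exists_minimal_set:
  assumes H: "H \<lhd> G" and X: "compact_space X" "topspace X \<noteq> {}"
  shows "\<exists>M. M \<noteq> {} \<and> M \<subseteq> topspace X \<and> (\<forall>y\<in>M. orbit_closure X act H y = M)"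
proof -
  have sg: "subgroup H G" using H by (rule normal_imp_subgroup)
  define \<O> where "\<O> = {U. openin X U \<and> U \<noteq> topspace X \<and> (\<forall>h\<in>H. \<forall>x\<in>topspace X - U. act h x \<notin> U)}"
  have ne: "{} \<in> \<O>" using X(2)[symmetric] openin_empty[of X] unfolding \<O>_def by blast
  have ch: "\<Union>\<C> \<in> \<O>" if \<C>: "\<C> \<noteq> {}" "subset.chain \<O> \<C>" for \<C>
  proof -
    have sub: "\<C> \<subseteq> \<O>" using \<C>(2) by (simp add: subset.chain_def)
    have "\<Union>\<C> \<noteq> topspace X"
    proof
      assume eq: "\<Union>\<C> = topspace X"
      moreover have "openin X U" if "U \<in> \<C>" for U using sub that by (auto simp: \<O>_def)
      ultimately obtain \<F> where \<F>: "finite \<F>" "\<F> \<subseteq> \<C>" "topspace X \<subseteq> \<Union>\<F>"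
        using compactinD[of X "topspace X" \<C>] X(1) by (auto simp: compact_space_def)
      have "\<F> \<noteq> {}" using \<F>(3) X(2) by auto
      moreover have "subset.chain \<O> \<F>"
        unfolding subset_chain_def
      proof (intro conjI ballI)
        show "\<F> \<subseteq> \<O>" using \<F>(2) sub by (rule order_trans)
        fix A B assume "A \<in> \<F>" "B \<in> \<F>"
        then have "A \<in> \<C>" "B \<in> \<C>" using \<F>(2) by auto
        then show "A \<subseteq> B \<or> B \<subseteq> A" using \<C>(2) by (simp add: subset_chain_def)
      qed
      \<comment> \<open>A finite nonempty chain contains its union, so if the chain covered
        \<open>X\<close>, compactness would make one of its members all of \<open>X\<close>.\<close>
      ultimately have "\<Union>\<F> \<in> \<F>" by (rule Union_in_chain[OF \<F>(1)])
      then obtain U where U: "U \<in> \<O>" "topspace X \<subseteq> U" using sub \<F> by blast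
      then have "U \<subseteq> topspace X" by (simp add: \<O>_def openin_subset)
      with U show False by (auto simp: \<O>_def)
    qed
    moreover have "openin X (\<Union>\<C>)" using sub by (intro openin_Union) (auto simp: \<O>_def)
    moreover have "act h x \<notin> \<Union>\<C>" if "h \<in> H" "x \<in> topspace X - \<Union>\<C>" for h x
      using sub that unfolding \<O>_def by blast
    ultimately show ?thesis unfolding \<O>_def by blast
  qed
  have "\<exists>U\<in>\<O>. \<forall>V\<in>\<O>. U \<subseteq> V \<longrightarrow> V = U"
    using ne ch by (intro subset_Zorn_nonempty) auto
  then obtain U where U: "U \<in> \<O>" "\<And>V. V \<in> \<O> \<Longrightarrow> U \<subseteq> V \<Longrightarrow> V = U" by blast
  have Uo: "openin X U" "U \<subset> topspace X" "\<And>h x. h \<in> H \<Longrightarrow> x \<in> topspace X - U \<Longrightarrow> act h x \<notin> U"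
    using U(1) openin_subset[of X U] by (auto simp: \<O>_def)
  show ?thesis
  proof (intro exI[of _ "topspace X - U"] conjI ballI)
    fix y assume y: "y \<in> topspace X - U"
    let ?C = "orbit_closure X act H y"
    have sub: "?C \<subseteq> topspace X - U"
      using Uo y act_closed subgroup.mem_carrier[OF sg]
      by (intro orbit_closure_minimal) auto
    \<comment> \<open>The complement of the orbit closure competes with \<open>U\<close> and
      contains it, so maximality forces equality.\<close>
    have "topspace X - ?C \<in> \<O>"
      unfolding \<O>_def
    proof (intro CollectI conjI ballI)
      show "openin X (topspace X - ?C)" by (simp add: closedin_orbit_closure openin_diff)
      show "topspace X - ?C \<noteq> topspace X" using mem_orbit_closure_self[OF sg] y by blast
      show "act h x \<notin> topspace X - ?C" if "h \<in> H" "x \<in> topspace X - (topspace X - ?C)" for h x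
        using orbit_closure_invariant[OF H that(1)] that y by blast
    qed
    moreover have "U \<subseteq> topspace X - ?C" using sub Uo(2) by blast
    ultimately have "topspace X - ?C = U" using U(2) by blast
    then show "?C = topspace X - U" using orbit_closure_subset[of H y] by blast
  qed (use Uo in auto)
qed

end

section \<open>The closed partition of \<open>X\<close> into orbit closures\<close>

locale cocompact_minimal_flow = flow_system G TG X act for G (structure) and TG X act +
  fixes H
  assumes compact: "compact_space X"
    and minimal: "minimal_flow G TG X act"
    and ncc: "H \<in> normal_cocompact_closed G TG"
begin

lemma normal: "H \<lhd> G" and cocompact: "compact_space (left_coset_space G TG H)"
  using ncc by (auto simp: normal_cocompact_closed_def)

lemma subgroup: "subgroup H G"
  by (rule normal_imp_subgroup[OF normal])

abbreviation oc where "oc \<equiv> orbit_closure X act H"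

text \<open>The translates of one minimal set of \<open>H\<close> fill a closed \<open>G\<close>-invariant set, hence all of \<open>X\<close>.\<close>

lemma translates_of_minimal_set:
  assumes "topspace X \<noteq> {}"
  shows "\<exists>M. closedin X M \<and> (\<forall>y\<in>M. oc y = M) \<and>
    (\<forall>x\<in>topspace X. \<exists>t\<in>carrier G. act (inv t) x \<in> M)"
proof -
  obtain M where "M \<noteq> {} \<and> M \<subseteq> topspace X \<and> (\<forall>y\<in>M. oc y = M)"
    using exists_minimal_set[OF normal compact assms] by (rule exE)
  then have M: "M \<noteq> {}" "M \<subseteq> topspace X" "\<And>y. y \<in> M \<Longrightarrow> oc y = M" by simp_all
  obtain m where m: "m \<in> M" using M(1) by blast
  have cl: "closedin X M" using closedin_orbit_closure[of H m] M(3)[OF m] by simp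
  have inv_M: "act h y \<in> M" if "h \<in> H" "y \<in> M" for h y
    using orbit_closure_invariant[OF normal that(1), of y y] that M by auto
  \<comment> \<open>\<open>C\<close> consists of the pairs (t, x) with x in tM, so its projection to
    \<open>X\<close> is the union of all translates of \<open>M\<close>.\<close>
  define C where "C = {p \<in> topspace (prod_topology TG X). (\<lambda>(t, x). act (inv t) x) p \<in> M}"
  have C: "(t, x) \<in> C \<longleftrightarrow> t \<in> carrier G \<and> x \<in> topspace X \<and> act (inv t) x \<in> M" for t x
    by (auto simp: C_def topspace_eq_carrier)
  have "closedin (prod_topology TG X) C"
    unfolding C_def by (rule closedin_continuous_map_preimage[OF continuous_map_inv_act cl])
  \<comment> \<open>Saturation holds because the inverse of \<open>h\<close> again lies in
    \<open>H\<close> and so maps \<open>M\<close> into itself.\<close>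
  moreover have "(t \<otimes> h, x) \<in> C" if "(t, x) \<in> C" "h \<in> H" for t h x
    using that C inv_M[OF subgroup.m_inv_closed[OF subgroup that(2)]]
      subgroup.mem_carrier[OF subgroup that(2)] by (simp add: inv_mult_group act_mult)
  ultimately have TM: "closedin X (snd ` C)"
    by (rule closedin_cocompact_projection[OF subgroup cocompact])
  have "orbit_closure X act (carrier G) m \<subseteq> snd ` C"
  proof (rule orbit_closure_minimal[OF TM])
    have "(\<one>, m) \<in> C" using m M(2) by (auto simp: C act_one)
    then show "m \<in> snd ` C" by force
    fix s x assume s: "s \<in> carrier G" and "x \<in> snd ` C"
    then obtain t where t: "(t, x) \<in> C" by auto
    then have "(s \<otimes> t, act s x) \<in> C"
      using s unfolding C by (simp add: inv_mult_group act_mult act_closed act_inv_act)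
    then show "act s x \<in> snd ` C" by force
  qed
  then have "topspace X \<subseteq> snd ` C"
    using minimal subsetD[OF M(2) m] by (simp add: minimal_flow_def)
  then have "\<exists>t\<in>carrier G. act (inv t) x \<in> M" if "x \<in> topspace X" for x
    using that C by force
  then show ?thesis using cl M(3) by (intro exI[of _ M] conjI ballI)
qed

text \<open>Some translation carries \<open>x\<close> into the minimal set \<open>M\<close>, hence
  carries its whole orbit closure onto \<open>M\<close>. There all orbit closures coincide, and
  translating back gives the claim for \<open>x\<close> and \<open>y\<close>.\<close>

lemma orbit_closure_eq:
  assumes x: "x \<in> topspace X" and y: "y \<in> oc x"
  shows "oc y = oc x"
proof -
  have ne: "topspace X \<noteq> {}" using x by blast
  obtain M where "closedin X M \<and> (\<forall>y\<in>M. oc y = M) \<and>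
      (\<forall>x\<in>topspace X. \<exists>t\<in>carrier G. act (inv t) x \<in> M)"
    using translates_of_minimal_set[OF ne] by (rule exE)
  then have M: "closedin X M" "\<And>y. y \<in> M \<Longrightarrow> oc y = M"
      "\<And>x. x \<in> topspace X \<Longrightarrow> \<exists>t\<in>carrier G. act (inv t) x \<in> M"
    by simp_all
  obtain t where t: "t \<in> carrier G" "act (inv t) x \<in> M" using M(3) x by blast
  have yX: "y \<in> topspace X" using y orbit_closure_subset by blast
  have *: "act (inv t) ` oc x = M"
    using act_image_orbit_closure[OF normal inv_closed[OF t(1)] x] M(2) t by simp
  then have "oc (act (inv t) y) = oc (act (inv t) x)" using y M(2) t by blast
  then have "act t ` oc (act (inv t) y) = act t ` oc (act (inv t) x)" by simp
  then show ?thesis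
    using act_image_orbit_closure[OF normal t(1)] t x yX by (simp add: act_closed act_act_inv)
qed

lemma mem_orbit_closure_iff:
  assumes "x \<in> topspace X"
  shows "y \<in> oc x \<longleftrightarrow> y \<in> topspace X \<and> oc y = oc x"
  using assms orbit_closure_eq orbit_closure_subset mem_orbit_closure_self[OF subgroup] by blast

text \<open>The relation is the union of the squares tM \<times> tM. It is therefore the projection
  along the group of a closed set that is saturated under \<open>H\<close>.\<close>

lemma closedin_orbit_closure_rel:
  "closedin (prod_topology X X) {(x, y). x \<in> topspace X \<and> y \<in> topspace X \<and> oc x = oc y}"
proof (cases "topspace X = {}")
  case True
  then show ?thesis by simp
next
  case False
  obtain M where "closedin X M \<and> (\<forall>y\<in>M. oc y = M) \<and>
      (\<forall>x\<in>topspace X. \<exists>t\<in>carrier G. act (inv t) x \<in> M)"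
    using translates_of_minimal_set[OF False] by (rule exE)
  then have M: "closedin X M" "\<And>y. y \<in> M \<Longrightarrow> oc y = M"
      "\<And>x. x \<in> topspace X \<Longrightarrow> \<exists>t\<in>carrier G. act (inv t) x \<in> M"
    by simp_all
  have MX: "M \<subseteq> topspace X" using M(1) by (rule closedin_subset)
  have inv_M: "act h y \<in> M" if "h \<in> H" "y \<in> M" for h y
    using orbit_closure_invariant[OF normal that(1), of y y] that M(2) MX by auto
  \<comment> \<open>\<open>f\<close> applies the inverse of the group coordinate to both points, so
    the preimage of \<open>M \<times> M\<close> collects the triples (t, x, y) with both points in
    tM.\<close>
  define f where "f = (\<lambda>p. (act (inv (fst p)) (fst (snd p)), act (inv (fst p)) (snd (snd p))))"
  define C where "C = {p \<in> topspace (prod_topology TG (prod_topology X X)). f p \<in> M \<times> M}"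
  have C: "(t, x, y) \<in> C \<longleftrightarrow> t \<in> carrier G \<and> x \<in> topspace X \<and> y \<in> topspace X \<and>
      act (inv t) x \<in> M \<and> act (inv t) y \<in> M" for t x y
    by (auto simp: C_def f_def topspace_eq_carrier)
  have "continuous_map (prod_topology TG (prod_topology X X)) X
      (\<lambda>p. act (inv (fst p)) (k (snd p)))"
    if k: "continuous_map (prod_topology X X) X k" for k
  proof -
    have "continuous_map (prod_topology TG (prod_topology X X)) (prod_topology TG X)
        (\<lambda>p. (fst p, k (snd p)))"
      by (intro continuous_map_pairedI continuous_map_fst
          continuous_map_compose[OF continuous_map_snd k, unfolded o_def])
    from continuous_map_compose[OF this continuous_map_inv_act] show ?thesis
      by (simp add: o_def)
  qed
  from this[OF continuous_map_fst] this[OF continuous_map_snd]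
  have "continuous_map (prod_topology TG (prod_topology X X)) (prod_topology X X) f"
    unfolding f_def by (intro continuous_map_pairedI)
  moreover have "closedin (prod_topology X X) (M \<times> M)"
    using M(1) by (simp add: closedin_prod_Times_iff)
  ultimately have "closedin (prod_topology TG (prod_topology X X)) C"
    unfolding C_def by (rule closedin_continuous_map_preimage)
  moreover have "(t \<otimes> h, p) \<in> C" if "(t, p) \<in> C" "h \<in> H" for t h p
    using that C inv_M[OF subgroup.m_inv_closed[OF subgroup that(2)]]
      subgroup.mem_carrier[OF subgroup that(2)]
    by (cases p) (simp add: inv_mult_group act_mult)
  ultimately have "closedin (prod_topology X X) (snd ` C)"
    by (rule closedin_cocompact_projection[OF subgroup cocompact])
  moreover have "snd ` C = {(x, y). x \<in> topspace X \<and> y \<in> topspace X \<and> oc x = oc y}"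
  proof (intro equalityI subsetI)
    fix p assume "p \<in> snd ` C"
    then obtain t x y where p: "p = (x, y)" and txy: "(t, x, y) \<in> C" by (cases p) force
    then have t: "t \<in> carrier G" and xy: "x \<in> topspace X" "y \<in> topspace X"
      and M': "act (inv t) x \<in> M" "act (inv t) y \<in> M" using C by auto
    have "oc z = act t ` M" if "z \<in> topspace X" "act (inv t) z \<in> M" for z
      using act_image_orbit_closure[OF normal t, of "act (inv t) z"] that M(2) t
      by (simp add: act_closed act_act_inv)
    then show "p \<in> {(x, y). x \<in> topspace X \<and> y \<in> topspace X \<and> oc x = oc y}"
      using p xy M' by simp
  next
    fix p assume "p \<in> {(x, y). x \<in> topspace X \<and> y \<in> topspace X \<and> oc x = oc y}"
    then obtain x y where p: "p = (x, y)" and xy: "x \<in> topspace X" "y \<in> topspace X" "oc x = oc y"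
      by auto
    obtain t where t: "t \<in> carrier G" "act (inv t) x \<in> M" using M(3) xy by blast
    \<comment> \<open>Points with equal orbit closures still have equal ones after translation. As
      the translate of \<open>x\<close> lies in \<open>M\<close>, the orbit closure of the translate
      of \<open>y\<close> is \<open>M\<close>, and it contains that translate.\<close>
    have "oc (act (inv t) y) = oc (act (inv t) x)"
      using act_image_orbit_closure[OF normal inv_closed[OF t(1)]] xy by metis
    then have "act (inv t) y \<in> M"
      using mem_orbit_closure_self[OF subgroup act_closed[OF inv_closed[OF t(1)] xy(2)]]
        M(2)[OF t(2)] by simp
    then have "(t, x, y) \<in> C" using t xy C by blast
    then show "p \<in> snd ` C" using p by force
  qed
  ultimately show ?thesis by simp
qed


section \<open>The quotient flow\<close>

abbreviation XH where "XH \<equiv> orbit_closure_space X act H"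

text \<open>Written with the relation to match \<open>orbit_closure_space\<close>. Outside
  \<open>topspace X\<close> the value is empty, which is why passing to \<open>oc\<close> goes
  through \<open>q_eq\<close>.\<close>

abbreviation q where "q \<equiv> \<lambda>x. orbit_closure_rel X act H `` {x}"

lemma q_eq: "x \<in> topspace X \<Longrightarrow> q x = oc x"
  by (rule orbit_closure_rel_Image)

lemma topspace_XH: "topspace XH = oc ` topspace X"
  unfolding orbit_closure_space_def topspace_quotient_topology
  by (rule image_cong[OF refl q_eq])

lemma quotient_map_q: "quotient_map X XH q"
  unfolding orbit_closure_space_def by (rule quotient_map_quotient_topology)

text \<open>The \<open>H\<close>-orbit closure of \<open>x\<close> meets an open set \<open>U\<close> iff \<open>x \<in> HU\<close>.\<close>

lemma open_map_q: "open_map X XH q"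
  unfolding open_map_def
proof (intro allI impI)
  fix U assume U: "openin X U"
  have UX: "U \<subseteq> topspace X" using U by (rule openin_subset)
  have "{x \<in> topspace X. q x \<in> q ` U} = (\<Union>h\<in>H. act h ` U)"
  proof (intro equalityI subsetI)
    fix x assume "x \<in> {x \<in> topspace X. q x \<in> q ` U}"
    then obtain u where u: "x \<in> topspace X" "u \<in> U" "q x = q u" by auto
    then have "u \<in> oc x"
      using UX q_eq mem_orbit_closure_self[OF subgroup, of u] by auto
    \<comment> \<open>An open set meeting the closure of an orbit already meets the orbit.\<close>
    then obtain h where h: "h \<in> H" "act h x \<in> U"
      using U u(2) unfolding orbit_closure_def in_closure_of by blast
    then have "x = act (inv h) (act h x)"
      using act_inv_act subgroup.mem_carrier[OF subgroup] u(1) by simp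
    then show "x \<in> (\<Union>h\<in>H. act h ` U)"
      using h subgroup.m_inv_closed[OF subgroup h(1)] by blast
  next
    fix x assume "x \<in> (\<Union>h\<in>H. act h ` U)"
    then obtain h u where hu: "h \<in> H" "u \<in> U" "x = act h u" by blast
    then have "u \<in> topspace X" "x \<in> topspace X"
      using UX act_closed subgroup.mem_carrier[OF subgroup] by auto
    moreover then have "q x = q u"
      using hu orbit_closure_act[OF subgroup] q_eq by simp
    ultimately show "x \<in> {x \<in> topspace X. q x \<in> q ` U}" using hu(2) by auto
  qed
  moreover have "openin X (\<Union>h\<in>H. act h ` U)"
    using openin_act_image[OF subgroup.mem_carrier[OF subgroup] U] by (intro openin_Union) auto
  ultimately show "openin XH (q ` U)"
    using UX by (simp add: orbit_closure_space_def openin_quotient_topology image_mono)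
qed

lemma continuous_map_q: "continuous_map X XH q"
  by (rule quotient_imp_continuous_map[OF quotient_map_q])

lemma image_q: "q ` topspace X = topspace XH"
  unfolding orbit_closure_space_def topspace_quotient_topology ..

lemma equivariant_q: "equivariant G X act (\<lambda>s C. act s ` C) q"
  unfolding equivariant_def
  using act_image_orbit_closure[OF normal] q_eq act_closed by simp

lemma flow_XH: "flow G TG XH (\<lambda>s C. act s ` C)"
  by (rule flow_open_quotient[OF is_monoid flow topspace_eq_carrier continuous_map_q open_map_q
        image_q equivariant_q])

lemma compact_space_XH: "compact_space XH"
  using image_compactin[of X "topspace X" XH q] compact continuous_map_q
  unfolding image_q compact_space_def by blast

lemma Hausdorff_space_XH: "Hausdorff_space XH"
proof (rule Hausdorff_space_open_quotient[OF quotient_map_q open_map_q])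
  have "{(x, y). x \<in> topspace X \<and> y \<in> topspace X \<and> q x = q y} =
      {(x, y). x \<in> topspace X \<and> y \<in> topspace X \<and> oc x = oc y}"
    by (simp add: q_eq cong: conj_cong)
  then show "closedin (prod_topology X X)
      {(x, y). x \<in> topspace X \<and> y \<in> topspace X \<and> q x = q y}"
    using closedin_orbit_closure_rel by simp
qed

lemma flow_factor_XH: "flow_factor G TG X act XH (\<lambda>s C. act s ` C)"
  unfolding flow_factor_def using flow flow_XH continuous_map_q image_q equivariant_q by blast

section \<open>Almost periodicity of the quotient flow\<close>

lemma act_image_XH_trivial:
  assumes "h \<in> H" "z \<in> topspace XH"
  shows "act h ` z = z"
proof -
  obtain x where "x \<in> topspace X" "z = oc x" using assms(2) by (auto simp: topspace_XH)
  then show ?thesis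
    using act_image_orbit_closure[OF normal subgroup.mem_carrier[OF subgroup assms(1)]]
      orbit_closure_act[OF subgroup assms(1)] by simp
qed

text \<open>Compactness of X/H gives one neighbourhood \<open>U\<close> of the identity whose
  elements move every point \<alpha>-little. Since \<open>H\<close> acts trivially,
  \<open>U <#> H\<close> moves points no further, and co-compactness makes it syndetic.\<close>

lemma almost_periodic_XH: "almost_periodic_flow G TG XH (\<lambda>s C. act s ` C)"
proof -
  have "\<exists>A. syndetic G TG A \<and> (\<forall>z\<in>topspace XH. (\<lambda>t. act t ` z) ` A \<subseteq> \<alpha> `` {z})"
    if \<alpha>: "\<alpha> \<in> diagonal_nbhds XH" for \<alpha>
  proof -
    obtain W where W: "openin (prod_topology XH XH) W" "Id_on (topspace XH) \<subseteq> W" "W \<subseteq> \<alpha>"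
      using \<alpha> unfolding diagonal_nbhds_def by blast
    \<comment> \<open>Pairing a point with its image turns \<alpha>-smallness of the motion into
      membership in the open set \<open>W\<close>.\<close>
    let ?f = "\<lambda>p. (snd p, act (fst p) ` snd p)"
    let ?W = "{p \<in> topspace (prod_topology TG XH). ?f p \<in> W}"
    have "continuous_map (prod_topology TG XH) XH (\<lambda>p. act (fst p) ` snd p)"
      using flow_XH by (simp add: flow_def case_prod_unfold)
    then have "continuous_map (prod_topology TG XH) (prod_topology XH XH) ?f"
      by (intro continuous_map_pairedI continuous_map_snd)
    then have "openin (prod_topology TG XH) ?W"
      using W(1) by (rule openin_continuous_map_preimage)
    moreover have "{\<one>} \<times> topspace XH \<subseteq> ?W"
    proof
      fix p assume "p \<in> {\<one>} \<times> topspace XH"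
      then obtain z where z: "p = (\<one>, z)" "z \<in> topspace XH" by blast
      then have "act \<one> ` z = z" using flow_XH by (simp add: flow_def)
      moreover have "(z, z) \<in> W" using z(2) W(2) by blast
      ultimately show "p \<in> ?W" using z by (simp add: topspace_eq_carrier)
    qed
    moreover have "compactin XH (topspace XH)" "\<one> \<in> topspace TG"
      using compact_space_XH by (simp_all add: compact_space_def topspace_eq_carrier)
    \<comment> \<open>The tube lemma along the compact slice over the identity makes
      \<open>U\<close> independent of the point.\<close>
    ultimately have "\<exists>U V. openin TG U \<and> openin XH V \<and> \<one> \<in> U \<and> topspace XH \<subseteq> V \<and> U \<times> V \<subseteq> ?W"
      by (intro tube_lemma_right)
    then obtain U V where UV: "openin TG U" "\<one> \<in> U" "topspace XH \<subseteq> V" "U \<times> V \<subseteq> ?W"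
      by meson
    have Uc: "U \<subseteq> carrier G" using openin_subset[OF UV(1)] by (simp add: topspace_eq_carrier)
    let ?A = "U <#> H"
    have Ac: "?A \<subseteq> carrier G" using setmult_subset_G[OF Uc subgroup.subset[OF subgroup]] .
    have "openin TG (t <# U) \<and> t \<in> t <# U" if t: "t \<in> carrier G" for t
    proof
      have "t <# U = {s \<in> topspace TG. inv t \<otimes> s \<in> U}"
      proof (intro equalityI subsetI)
        fix s assume "s \<in> t <# U"
        then obtain u where u: "u \<in> U" "s = t \<otimes> u" by (auto simp: l_coset_def)
        moreover have "u \<in> carrier G" using u Uc by blast
        ultimately show "s \<in> {s \<in> topspace TG. inv t \<otimes> s \<in> U}"
          using t by (simp add: topspace_eq_carrier m_assoc[symmetric])
      next
        fix s assume "s \<in> {s \<in> topspace TG. inv t \<otimes> s \<in> U}"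
        then have s: "s \<in> carrier G" "inv t \<otimes> s \<in> U" by (auto simp: topspace_eq_carrier)
        have "s = t \<otimes> (inv t \<otimes> s)" using s(1) t by (simp add: m_assoc[symmetric])
        with s(2) show "s \<in> t <# U" unfolding l_coset_def by blast
      qed
      then show "openin TG (t <# U)"
        using openin_continuous_map_preimage[OF continuous_map_mult_left UV(1), of "inv t"] t
        by simp
      show "t \<in> t <# U" using t UV(2) unfolding l_coset_def by (force intro: bexI[of _ \<one>])
    qed
    then obtain F where F: "finite F" "F \<subseteq> carrier G" "carrier G = (\<Union>t\<in>F. (t <# U) <#> H)"
      using cocompact_finite_cover[OF subgroup cocompact, of "\<lambda>t. t <# U"] by metis
    \<comment> \<open>Syndeticity asks for K with the group equal to the inverse of K times
      \<open>?A\<close>; the finite set \<open>F\<close> of translates is therefore inverted to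
      serve as K.\<close>
    have "syndetic G TG ?A"
      unfolding syndetic_def
    proof (intro conjI exI[of _ "set_inv F"])
      show "?A \<subseteq> carrier G" by (rule Ac)
      show "set_inv F \<noteq> {}" using F(3) one_closed by (auto simp: SET_INV_def)
      have "set_inv F \<subseteq> topspace TG" "finite (set_inv F)"
        using F(1,2) by (auto simp: SET_INV_def topspace_eq_carrier)
      then show "compactin TG (set_inv F)" by (simp add: finite_imp_compactin)
      have "set_inv (set_inv F) = F"
        using F(2) by (force simp: SET_INV_def)
      moreover have "(\<Union>t\<in>F. (t <# U) <#> H) = F <#> ?A"
      proof -
        have "(t <# U) <#> H = t <# ?A" if "t \<in> F" for t
          using that F(2) Uc subgroup.subset[OF subgroup]
          by (simp add: l_coset_eq_set_mult set_mult_assoc subset_eq)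
        moreover have "F <#> ?A = (\<Union>t\<in>F. t <# ?A)"
          by (simp only: set_mult_def[of G F] l_coset_def)
        ultimately show ?thesis by simp
      qed
      ultimately show "carrier G = set_inv (set_inv F) <#> ?A" using F(3) by simp
    qed
    moreover have "(\<lambda>t. act t ` z) ` ?A \<subseteq> \<alpha> `` {z}" if z: "z \<in> topspace XH" for z
    proof (rule image_subsetI)
      fix a assume "a \<in> ?A"
      then obtain u h where uh: "u \<in> U" "h \<in> H" "a = u \<otimes> h" by (auto simp: set_mult_def)
      then have "u \<in> carrier G" "h \<in> carrier G" using Uc subgroup.mem_carrier[OF subgroup] by auto
      then have "act a ` z = act u ` act h ` z"
        using flow_XH z uh(3) by (simp add: flow_def)
      also have "\<dots> = act u ` z" using act_image_XH_trivial[OF uh(2) z] by simp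
      finally have "act a ` z = act u ` z" .
      moreover have "(u, z) \<in> ?W" using UV uh(1) z by blast
      ultimately show "act a ` z \<in> \<alpha> `` {z}" using W(3) by auto
    qed
    ultimately show ?thesis by blast
  qed
  then show ?thesis
    unfolding almost_periodic_flow_def
    using flow_XH compact_space_XH Hausdorff_space_XH
      uniformity_of_space_diagonal_nbhds[OF compact_space_XH Hausdorff_space_XH] by blast
qed


section \<open>The evaluation map\<close>

abbreviation E where "E \<equiv> envelope G X act H"

text \<open>Since orbit closures partition \<open>X\<close>, moving \<open>x\<close> into its orbit
  closure is the same as preserving that closure. The envelope thus becomes a setwise stabiliser,
  which makes its subgroup property visible.\<close>

lemma mem_envelope_iff:
  assumes "x \<in> topspace X"
  shows "t \<in> E x \<longleftrightarrow> t \<in> carrier G \<and> act t ` oc x = oc x"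
proof (cases "t \<in> carrier G")
  case True
  then show ?thesis
    using mem_orbit_closure_iff[OF assms, of "act t x"] act_closed[OF True assms]
      act_image_orbit_closure[OF normal True assms]
    by (simp add: envelope_def)
qed (simp add: envelope_def)

lemma act_image_inv:
  assumes "t \<in> carrier G" "z \<subseteq> topspace X"
  shows "act (inv t) ` act t ` z = z"
proof -
  have "(\<lambda>x. act (inv t) (act t x)) ` z = (\<lambda>x. x) ` z"
    using assms by (intro image_cong) (auto simp: act_inv_act)
  then show ?thesis by (simp add: image_image)
qed

lemma act_image_mult:
  assumes "s \<in> carrier G" "t \<in> carrier G" "z \<subseteq> topspace X"
  shows "act (s \<otimes> t) ` z = act s ` act t ` z"
  unfolding image_image using assms by (intro image_cong) (auto simp: act_mult)

lemma subgroup_envelope: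
  assumes x: "x \<in> topspace X"
  shows "subgroup (E x) G"
proof (rule subgroupI)
  note iff = mem_envelope_iff[OF x]
  note sub = orbit_closure_subset[of H x]
  show "E x \<subseteq> carrier G" using iff by blast
  have "act \<one> ` oc x = (\<lambda>y. y) ` oc x" using sub by (intro image_cong) (auto simp: act_one)
  then have "\<one> \<in> E x" using iff by simp
  then show "E x \<noteq> {}" by blast
  fix s t assume s: "s \<in> E x" and t: "t \<in> E x"
  show "inv s \<in> E x" using s iff act_image_inv[OF _ sub, of s] by simp
  show "s \<otimes> t \<in> E x" using s t iff act_image_mult[OF _ _ sub, of s t] by simp
qed

text \<open>This inclusion transfers compactness from T/H to the coset space of the
  envelope.\<close>

lemma subset_envelope:
  assumes x: "x \<in> topspace X"
  shows "H \<subseteq> E x"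
proof
  fix h assume h: "h \<in> H"
  have "oc x \<in> topspace XH" using x by (simp add: topspace_XH)
  then show "h \<in> E x"
    using mem_envelope_iff[OF x] subgroup.mem_carrier[OF subgroup h] act_image_XH_trivial[OF h]
    by simp
qed

text \<open>The orbit-stabiliser correspondence for the orbit closure of \<open>x\<close>; it
  supplies injectivity of the evaluation map.\<close>

lemma act_image_eq_iff:
  assumes x: "x \<in> topspace X" and s: "s \<in> carrier G" and t: "t \<in> carrier G"
  shows "act s ` oc x = act t ` oc x \<longleftrightarrow> s <# E x = t <# E x"
proof -
  note sub = orbit_closure_subset[of H x]
  have tsub: "act t ` oc x \<subseteq> topspace X" using sub t act_closed by auto
  have "act s ` oc x = act t ` oc x \<longleftrightarrow> act (inv s) ` act t ` oc x = oc x"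
  proof
    assume "act s ` oc x = act t ` oc x"
    then show "act (inv s) ` act t ` oc x = oc x" using act_image_inv[OF s sub] by simp
  next
    assume "act (inv s) ` act t ` oc x = oc x"
    then have "act s ` oc x = act (inv (inv s)) ` act (inv s) ` act t ` oc x" using s by simp
    then show "act s ` oc x = act t ` oc x"
      using act_image_inv[OF inv_closed[OF s] tsub] by simp
  qed
  also have "\<dots> \<longleftrightarrow> inv s \<otimes> t \<in> E x"
    using mem_envelope_iff[OF x] act_image_mult[OF inv_closed[OF s] t sub] s t by simp
  also have "\<dots> \<longleftrightarrow> s <# E x = t <# E x"
    using l_coset_eq_iff[OF subgroup_envelope[OF x] s t] by simp
  finally show ?thesis .
qed

text \<open>All points of the coset \<open>C\<close> move the orbit closure of \<open>x\<close> to the same place, so the union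
  below is the evaluation map without a choice of representative.\<close>

lemma evaluation_isomorphism:
  assumes x: "x \<in> topspace X"
  shows "\<exists>e. (\<forall>t\<in>carrier G. e (t <# E x) = act t ` oc x) \<and>
    flow_isomorphism G TG (left_coset_space G TG (E x)) (\<lambda>s C. s <# C) XH (\<lambda>s C. act s ` C) e"
proof (intro exI conjI ballI)
  let ?e = "\<lambda>C. \<Union>t\<in>C. act t ` oc x"
  let ?TE = "left_coset_space G TG (E x)"
  note sgE = subgroup_envelope[OF x]
  have e: "?e (t <# E x) = act t ` oc x" if t: "t \<in> carrier G" for t
  proof -
    have "act (t \<otimes> u) ` oc x = act t ` oc x" if u: "u \<in> E x" for u
      using u t mem_envelope_iff[OF x] act_image_mult[OF t _ orbit_closure_subset, of u H x] by simp
    moreover have "E x \<noteq> {}" using subgroup.one_closed[OF sgE] by blast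
    ultimately show ?thesis by (simp add: l_coset_def)
  qed
  then show "?e (t <# E x) = act t ` oc x" if "t \<in> carrier G" for t using that .
  have eo: "?e (t <# E x) = q (act t x)" if t: "t \<in> carrier G" for t
    using e[OF t] act_image_orbit_closure[OF normal t x] q_eq[OF act_closed[OF t x]] by simp
  have "continuous_map TG XH (q \<circ> (\<lambda>t. act t x))"
    by (rule continuous_map_compose[OF continuous_map_orbit[OF x] continuous_map_q])
  \<comment> \<open>Composed with the coset map, the evaluation map is the orbit map of
    \<open>x\<close> followed by \<open>q\<close>, so its continuity descends through the
    quotient.\<close>
  then have "continuous_map TG XH (?e \<circ> (\<lambda>t. t <# E x))"
    by (rule continuous_map_eq) (simp only: topspace_eq_carrier o_def eo)
  then have cont: "continuous_map ?TE XH ?e"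
    by (rule continuous_compose_quotient_map[OF quotient_map_l_coset])
  have surj: "?e ` topspace ?TE = topspace XH"
  proof
    show "?e ` topspace ?TE \<subseteq> topspace XH"
      using cont by (simp add: continuous_map_image_subset_topspace)
    show "topspace XH \<subseteq> ?e ` topspace ?TE"
    proof
      fix z assume "z \<in> topspace XH"
      then obtain y where y: "y \<in> topspace X" "z = oc y" by (auto simp: topspace_XH)
      have ne: "topspace X \<noteq> {}" using x by blast
      obtain M where "closedin X M \<and> (\<forall>y\<in>M. oc y = M) \<and>
          (\<forall>x\<in>topspace X. \<exists>t\<in>carrier G. act (inv t) x \<in> M)"
        using translates_of_minimal_set[OF ne] by (rule exE)
      then have M: "\<And>y. y \<in> M \<Longrightarrow> oc y = M"
          "\<And>x. x \<in> topspace X \<Longrightarrow> \<exists>t\<in>carrier G. act (inv t) x \<in> M"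
        by simp_all
      obtain s where s: "s \<in> carrier G" "act (inv s) x \<in> M" using M(2)[OF x] by blast
      obtain t where t: "t \<in> carrier G" "act (inv t) y \<in> M" using M(2)[OF y(1)] by blast
      have "act (inv s) ` oc x = M"
        using act_image_orbit_closure[OF normal inv_closed[OF s(1)] x] M(1)[OF s(2)] by simp
      moreover have "act t ` M = oc y"
        using act_image_orbit_closure[OF normal t(1), of "act (inv t) y"] M(1)[OF t(2)] t y(1)
        by (simp add: act_closed act_act_inv)
      \<comment> \<open>The minimal set \<open>M\<close> is the intermediate stop: the inverse of
        \<open>s\<close> carries the orbit closure of \<open>x\<close> to \<open>M\<close>, and
        \<open>t\<close> carries \<open>M\<close> to that of \<open>y\<close>. So every class is an
        actual translate, with no further closure needed.\<close>
      ultimately have "act (t \<otimes> inv s) ` oc x = z"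
        using act_image_mult[OF t(1) inv_closed[OF s(1)] orbit_closure_subset, of H x] y(2) by simp
      then have "?e ((t \<otimes> inv s) <# E x) = z" using e[of "t \<otimes> inv s"] s(1) t(1) by simp
      moreover have "(t \<otimes> inv s) <# E x \<in> topspace ?TE"
        using s(1) t(1) by (simp add: topspace_left_coset_space)
      ultimately show "z \<in> ?e ` topspace ?TE" by (rule image_eqI[OF sym])
    qed
  qed
  have inj: "inj_on ?e (topspace ?TE)"
  proof (rule inj_onI)
    fix C D assume CD: "C \<in> topspace ?TE" "D \<in> topspace ?TE" and eq: "?e C = ?e D"
    obtain s t where st: "s \<in> carrier G" "t \<in> carrier G" "C = s <# E x" "D = t <# E x"
      using CD by (auto simp: topspace_left_coset_space)
    then have "act s ` oc x = act t ` oc x" using eq e by simp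
    then show "C = D" using act_image_eq_iff[OF x st(1,2)] st by simp
  qed
  have "compact_space ?TE"
    using compact_left_coset_space_mono[OF subgroup sgE subset_envelope[OF x] cocompact] .
  \<comment> \<open>A continuous map from a compact space to a Hausdorff space is closed, which
    gives continuity of the inverse.\<close>
  then have "closed_map ?TE XH ?e"
    by (rule continuous_imp_closed_map[OF cont _ Hausdorff_space_XH])
  then have "homeomorphic_map ?TE XH ?e"
    by (rule bijective_closed_imp_homeomorphic_map[OF cont _ surj inj])
  moreover have "equivariant G ?TE (\<lambda>s C. s <# C) (\<lambda>s C. act s ` C) ?e"
    unfolding equivariant_def
  proof (intro ballI)
    fix s C assume s: "s \<in> carrier G" and C: "C \<in> topspace ?TE"
    obtain t where t: "t \<in> carrier G" "C = t <# E x"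
      using C by (auto simp: topspace_left_coset_space)
    have "s <# C = (s \<otimes> t) <# E x"
      using s t subgroup.subset[OF sgE] by (simp add: lcos_m_assoc)
    then have "?e (s <# C) = act (s \<otimes> t) ` oc x" using e s t(1) by simp
    also have "\<dots> = act s ` ?e C"
      using act_image_mult[OF s t(1) orbit_closure_subset, of H x] e[OF t(1)] t(2) by simp
    finally show "?e (s <# C) = act s ` ?e C" .
  qed
  ultimately show "flow_isomorphism G TG ?TE (\<lambda>s C. s <# C) XH (\<lambda>s C. act s ` C) ?e"
    unfolding flow_isomorphism_def using flow_left_coset_space[OF sgE] flow_XH by blast
qed

end

theorem theorem6p5:
  fixes G :: "('g, 'm) monoid_scheme"
    and TG :: "'g topology"
    and X :: "'x topology"
    and act :: "'g \<Rightarrow> 'x \<Rightarrow> 'x"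
    and H :: "'g set"
  assumes "topological_group G TG"
    and "Hausdorff_space TG"
    and "compact_space X"
    and "Hausdorff_space X"
    and "minimal_flow G TG X act"
    and "H \<in> normal_cocompact_closed G TG"
  shows "(\<forall>x \<in> topspace X. \<exists>e.
            (\<forall>t \<in> carrier G.
               e (t <#\<^bsub>G\<^esub> envelope G X act H x) = act t ` orbit_closure X act H x) \<and>
            flow_isomorphism G TG
              (left_coset_space G TG (envelope G X act H x)) (\<lambda>s C. s <#\<^bsub>G\<^esub> C)
              (orbit_closure_space X act H) (\<lambda>s C. act s ` C)
              e)
       \<and> almost_periodic_flow G TG (orbit_closure_space X act H) (\<lambda>s C. act s ` C)
       \<and> flow_factor G TG X act (orbit_closure_space X act H) (\<lambda>s C. act s ` C)"
proof -
  have "flow G TG X act" using assms(5) by (simp add: minimal_flow_def)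
  then interpret cocompact_minimal_flow G TG X act H
    by (intro cocompact_minimal_flow.intro flow_system.intro flow_system_axioms.intro
        cocompact_minimal_flow_axioms.intro assms)
  show ?thesis
    using evaluation_isomorphism almost_periodic_XH flow_factor_XH by (intro conjI ballI)
qed

end
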